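(* Let $M$ be a monoid (i.e., a cancellative commutative semigroup with identity). If $M$ is hereditarily atomic, i.e., every submonoid of $M$ is atomic, then $M$ satisfies the ascending chain condition on principal ideals (ACCP).
   Context: "Monoid" means a cancellative and commutative semigroup with identity, written additively. $\mathcal{U}(M)$ is the group of invertible elements of $M$. An element $a\in M\setminus\mathcal{U}(M)$ is an atom of $M$ if whenever $a=b+c$ with $b,c\in M$, either $b\in\mathcal{U}(M)$ or $c\in\mathcal{U}(M)$. An element of $M$ is atomic if it is invertible or can be written as a sum of finitely many atoms of $M$; $M$ is atomic if every element of $M$ is atomic. A principal ideal of $M$ is a subset of the form $b+M=\{b+m : m\in M\}$ with $b\in M$. $M$ satisfies the ACCP if for every ascending chain $(b_n+M)_{n\ge 1}$ of principal ideals of $M$ there is $n_0\in\mathbb{N}$ such that $b_n+M=b_{n+1}+M$ for every $n\ge n_0$. *)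

theory Defs
  imports "HOL-Algebra.Divisibility"
begin

text \<open>
  Monoids are written multiplicatively, as in HOL-Algebra: cancellative commutative monoids are
  the structures satisfying \<^locale>\<open>comm_monoid_cancel\<close>, and \<^term>\<open>Units M\<close> is the group of
  invertible elements of \<open>M\<close>. Note that units of a submonoid \<open>H\<close> are formed inside \<open>H\<close>, i.e. they
  are \<^term>\<open>Units (M\<lparr>carrier := H\<rparr>)\<close>, not \<open>H \<inter> Units M\<close>; hence the atoms of \<open>H\<close> need not be atoms
  of \<open>M\<close>.
\<close>

definition is_atom :: "('a, 'b) monoid_scheme \<Rightarrow> 'a \<Rightarrow> bool" where
  "is_atom M a \<longleftrightarrow> a \<in> carrier M - Units M \<and>
     (\<forall>b\<in>carrier M. \<forall>c\<in>carrier M. a = b \<otimes>\<^bsub>M\<^esub> c \<longrightarrow> b \<in> Units M \<or> c \<in> Units M)"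

text \<open>
  The empty list contributes only \<open>\<one>\<close>, which is a unit anyway.
\<close>

definition atomic_element :: "('a, 'b) monoid_scheme \<Rightarrow> 'a \<Rightarrow> bool" where
  "atomic_element M x \<longleftrightarrow> x \<in> Units M \<or>
     (\<exists>as. (\<forall>a\<in>set as. is_atom M a) \<and> x = foldr (\<otimes>\<^bsub>M\<^esub>) as \<one>\<^bsub>M\<^esub>)"

definition atomic_monoid :: "('a, 'b) monoid_scheme \<Rightarrow> bool" where
  "atomic_monoid M \<longleftrightarrow> (\<forall>x\<in>carrier M. atomic_element M x)"

definition hereditarily_atomic :: "('a, 'b) monoid_scheme \<Rightarrow> bool" where
  "hereditarily_atomic M \<longleftrightarrow> (\<forall>H. submonoid H M \<longrightarrow> atomic_monoid (M\<lparr>carrier := H\<rparr>))"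

text \<open>
  The principal ideal generated by \<open>b\<close> is \<open>b <#\<^bsub>M\<^esub> carrier M\<close>.
\<close>

definition satisfies_ACCP :: "('a, 'b) monoid_scheme \<Rightarrow> bool" where
  "satisfies_ACCP M \<longleftrightarrow>
     (\<forall>b :: nat \<Rightarrow> 'a.
        (\<forall>n. b n \<in> carrier M) \<and>
        (\<forall>n. b n <#\<^bsub>M\<^esub> carrier M \<subseteq> b (Suc n) <#\<^bsub>M\<^esub> carrier M) \<longrightarrow>
        (\<exists>n\<^sub>0. \<forall>n\<ge>n\<^sub>0. b n <#\<^bsub>M\<^esub> carrier M = b (Suc n) <#\<^bsub>M\<^esub> carrier M))"

end

theory Submission
  imports Defs "HOL-Library.Infinite_Set"
begin

text \<open>
  The proof is by contraposition. If the ACCP fails, there is a sequence \<open>B\<close> in \<open>M\<close> with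
  \<open>B i = B j \<otimes> q i j\<close> and \<open>q i j\<close> not invertible, whenever \<open>i < j\<close>. For indices
  \<open>0 = n 0 < n 1 < n 2 < \<dots>\<close> put \<open>d k = q (n k) (n (k + 1))\<close> and let \<open>H\<close> be the submonoid
  generated by all \<open>B (n k)\<close> and all \<open>d k\<close>. The generators are nonunits of \<open>M\<close>, so \<open>\<one>\<close> is the only
  unit of \<open>H\<close> and every atom of \<open>H\<close> is a generator. No \<open>B (n k)\<close> is an atom, since it equals
  \<open>B (n (k + 1)) \<otimes> d k\<close>. Hence \<open>H\<close> is not atomic as soon as \<open>B 0\<close> is not a product of elements
  \<open>d k\<close> (lemma \<open>not_atomic_monoid_span\<close>).

  The indices can be chosen one at a time so that \<open>B 0\<close> stays outside the submonoid \<open>D\<close> generated by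
  the \<open>d k\<close> found so far (lemma \<open>exists_avoiding_quotient\<close>). Suppose that after the index \<open>N\<close> no
  choice works. Then for every \<open>n > N\<close> there are \<open>y n \<in> D\<close> and an exponent \<open>m n\<close> with
  \<open>B 0 = y n \<otimes> q N n [^] m n\<close>, and \<open>m n > 0\<close> because \<open>B 0 \<notin> D\<close>. As \<open>D\<close> is finitely generated,
  Dickson's lemma yields \<open>i < j\<close> with \<open>y i\<close> dividing \<open>y j\<close> and \<open>m i \<le> m j\<close>. But
  \<open>q N j = q N i \<otimes> q i j\<close>, so the representation at \<open>j\<close> is a multiple of the one at \<open>i\<close> by a
  multiple of the nonunit \<open>q i j\<close>. Both are equal to \<open>B 0\<close>, and cancelling it makes \<open>q i j\<close> a
  unit, a contradiction.
\<close>

section \<open>Generated submonoids\<close>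

inductive_set monoid_span :: "('a, 'b) monoid_scheme \<Rightarrow> 'a set \<Rightarrow> 'a set"
  for M and S where
  one: "\<one>\<^bsub>M\<^esub> \<in> monoid_span M S"
| mult: "s \<in> S \<Longrightarrow> x \<in> monoid_span M S \<Longrightarrow> s \<otimes>\<^bsub>M\<^esub> x \<in> monoid_span M S"

lemma monoid_span_mono: "S \<subseteq> T \<Longrightarrow> monoid_span M S \<subseteq> monoid_span M T"
proof
  fix x assume "S \<subseteq> T" "x \<in> monoid_span M S"
  then show "x \<in> monoid_span M T"
    by (induction rule: monoid_span.induct[OF \<open>x \<in> _\<close>]) (auto intro: monoid_span.intros)
qed

text \<open>An element of the span involves only finitely many generators.\<close>

lemma monoid_span_Union_chain:
  fixes S :: "nat \<Rightarrow> 'a set"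
  assumes "\<And>k. S k \<subseteq> S (Suc k)" and "x \<in> monoid_span M (\<Union>k. S k)"
  shows "\<exists>k. x \<in> monoid_span M (S k)"
  using assms(2)
proof induction
  case one
  show ?case by (auto intro: monoid_span.one)
next
  case (mult s x)
  then obtain i j where ij: "s \<in> S i" "x \<in> monoid_span M (S j)" by auto
  have "S i \<subseteq> S (max i j)" "S j \<subseteq> S (max i j)"
    using lift_Suc_mono_le[of S, OF assms(1)] by simp_all
  then show ?case
    using ij monoid_span_mono[of "S j" "S (max i j)" M] monoid_span.mult[of s "S (max i j)"]
    by blast
qed

context comm_monoid
begin

lemma monoid_span_closed: "S \<subseteq> carrier G \<Longrightarrow> monoid_span G S \<subseteq> carrier G"
proof
  fix x assume "S \<subseteq> carrier G" "x \<in> monoid_span G S"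
  then show "x \<in> carrier G"
    by (induction rule: monoid_span.induct[OF \<open>x \<in> _\<close>]) auto
qed

lemma generator_in_monoid_span: "s \<in> S \<Longrightarrow> s \<in> carrier G \<Longrightarrow> s \<in> monoid_span G S"
  using monoid_span.mult[OF _ monoid_span.one, of s S G] by simp

lemma monoid_span_submonoid:
  assumes S: "S \<subseteq> carrier G"
  shows "submonoid (monoid_span G S) G"
proof
  show "monoid_span G S \<subseteq> carrier G" by (rule monoid_span_closed[OF S])
  show "\<one> \<in> monoid_span G S" by (rule monoid_span.one)
  fix x y assume "x \<in> monoid_span G S" and y: "y \<in> monoid_span G S"
  then show "x \<otimes> y \<in> monoid_span G S"
  proof (induction rule: monoid_span.induct)
    case one
    then show ?case using y monoid_span_closed[OF S] by auto
  next
    case (mult s x)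
    then have "s \<otimes> x \<otimes> y = s \<otimes> (x \<otimes> y)"
      using monoid_span_closed[OF S] S by (intro m_assoc) auto
    then show ?case using mult by (auto intro: monoid_span.mult)
  qed
qed

lemma monoid_span_insert:
  assumes "insert d S \<subseteq> carrier G" and "x \<in> monoid_span G (insert d S)"
  shows "\<exists>y\<in>monoid_span G S. \<exists>m::nat. x = y \<otimes> d [^] m"
  using assms(2)
proof induction
  case one
  have "\<one> = \<one> \<otimes> d [^] (0::nat)" by simp
  then show ?case by (blast intro: monoid_span.one)
next
  case (mult s x)
  then obtain y and m :: nat where y: "y \<in> monoid_span G S" and x: "x = y \<otimes> d [^] m"
    by blast
  have c: "d \<in> carrier G" "y \<in> carrier G" "s \<in> carrier G"
    using assms(1) mult.hyps y monoid_span_closed[of S] by auto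
  from mult.hyps(1) show ?case
  proof
    assume "s = d"
    then have "s \<otimes> x = y \<otimes> d [^] Suc m"
      using c x by (simp add: m_ac)
    then show ?thesis using y by blast
  next
    assume "s \<in> S"
    then have "s \<otimes> y \<in> monoid_span G S" using y by (rule monoid_span.mult)
    moreover have "s \<otimes> x = (s \<otimes> y) \<otimes> d [^] m"
      using c x by (simp add: m_assoc)
    ultimately show ?thesis by blast
  qed
qed

end

section \<open>Dickson's lemma for finitely generated submonoids\<close>

text \<open>
  Each new index minimises \<open>f\<close> over all indices beyond the previous one; minimising over a
  smaller set cannot decrease the value.
\<close>

lemma nat_seq_mono_subseq:
  fixes f :: "nat \<Rightarrow> nat"
  shows "\<exists>r::nat \<Rightarrow> nat. strict_mono r \<and> mono (f \<circ> r)"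
proof -
  have least: "\<exists>n. Q n \<and> (\<forall>m. Q m \<longrightarrow> f n \<le> f m)" if "Q k" for Q and k
    using ex_has_least_nat[of Q k f] that by blast
  have "\<exists>r. \<forall>k. (\<forall>m\<ge>r k. f (r k) \<le> f m) \<and> r k < r (Suc k)"
  proof (rule dependent_nat_choice)
    show "\<exists>n. \<forall>m\<ge>n. f n \<le> f m" using least[of "\<lambda>_. True"] by auto
  next
    fix n
    obtain n' where "n < n'" "\<And>m. n < m \<Longrightarrow> f n' \<le> f m"
      using least[of "\<lambda>m. n < m" "Suc n"] by auto
    then show "\<exists>n'. (\<forall>m\<ge>n'. f n' \<le> f m) \<and> n < n'" by (intro exI[of _ n']) auto
  qed
  then obtain r where r: "\<And>k m. r k \<le> m \<Longrightarrow> f (r k) \<le> f m" "\<And>k. r k < r (Suc k)"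
    by blast
  then have "strict_mono r" by (simp add: strict_mono_Suc_iff)
  moreover from this have "mono (f \<circ> r)"
    using r(1) by (auto intro!: monoI simp: strict_mono_less_eq)
  ultimately show ?thesis by blast
qed

context comm_monoid
begin

lemma pow_divides_pow:
  assumes "x \<in> carrier G" "(m::nat) \<le> n"
  shows "x [^] m divides x [^] n"
  using assms by (intro dividesI[of "x [^] (n - m)"]) (auto simp: nat_pow_mult)

lemma mult_divides_mult:
  assumes "a divides b" "c divides d" "a \<in> carrier G" "c \<in> carrier G"
  shows "a \<otimes> c divides b \<otimes> d"
proof -
  obtain u v where "b = a \<otimes> u" "d = c \<otimes> v" "u \<in> carrier G" "v \<in> carrier G"
    using assms(1,2) by (auto elim!: dividesE)
  then show ?thesis
    using assms(3,4) by (intro dividesI[of "u \<otimes> v"]) (auto simp: m_ac)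
qed

text \<open>
  Dickson's lemma, by induction on the generators: a subsequence that is good for the part
  generated by \<open>S\<close> is thinned out once more to make the exponents of the new generator increase.
  Having a whole subsequence, not just one pair \<open>i < j\<close>, is what lets the induction go through.
\<close>

lemma monoid_span_divides_subseq:
  assumes "finite S" "S \<subseteq> carrier G" "\<And>n::nat. f n \<in> monoid_span G S"
  shows "\<exists>r::nat \<Rightarrow> nat. strict_mono r \<and> (\<forall>i j. i \<le> j \<longrightarrow> f (r i) divides f (r j))"
  using assms
proof (induction S arbitrary: f rule: finite_induct)
  case empty
  have "f n = \<one>" for n
    using empty(2)[of n] by (auto elim: monoid_span.cases)
  then have "\<forall>i j. i \<le> j \<longrightarrow> f (id i) divides f (id j)" by simp
  then show ?case by (intro exI[of _ id]) (simp add: strict_mono_def)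
next
  case (insert d S)
  have "\<exists>y m. y \<in> monoid_span G S \<and> f n = y \<otimes> d [^] (m::nat)" for n
    using monoid_span_insert[of d S "f n"] insert.prems by auto
  then obtain y and m :: "nat \<Rightarrow> nat"
    where y: "\<And>n. y n \<in> monoid_span G S" and f: "\<And>n. f n = y n \<otimes> d [^] m n"
    by metis
  obtain r :: "nat \<Rightarrow> nat" where r: "strict_mono r" "\<And>i j. i \<le> j \<Longrightarrow> y (r i) divides y (r j)"
    using insert.IH[of y] y insert.prems by auto
  obtain s :: "nat \<Rightarrow> nat" where s: "strict_mono s" "mono (m \<circ> r \<circ> s)"
    using nat_seq_mono_subseq[of "m \<circ> r"] by auto
  have c: "d \<in> carrier G" "\<And>n. y n \<in> carrier G"
    using insert.prems y monoid_span_closed[of S] by auto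
  have "f ((r \<circ> s) i) divides f ((r \<circ> s) j)" if "i \<le> j" for i j
  proof -
    have "y (r (s i)) divides y (r (s j))"
      using that s(1) r(2) by (simp add: strict_mono_less_eq)
    moreover have "d [^] m (r (s i)) divides d [^] m (r (s j))"
      using monoD[OF s(2) that] c by (simp add: pow_divides_pow)
    ultimately show ?thesis
      using c by (simp add: f mult_divides_mult)
  qed
  moreover have "strict_mono (r \<circ> s)"
    using r(1) s(1) by (simp add: strict_mono_def)
  ultimately show ?case by blast
qed

section \<open>Submonoids generated by nonunits\<close>

text \<open>
  A product that contains a nonunit of the ambient monoid is again a nonunit, even before
  inverses are required to lie in the submonoid.
\<close>

lemma Units_monoid_span:
  assumes S: "S \<subseteq> carrier G - Units G"
  shows "Units (G\<lparr>carrier := monoid_span G S\<rparr>) = {\<one>}"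
proof
  have c: "monoid_span G S \<subseteq> carrier G" using S by (intro monoid_span_closed) auto
  show "Units (G\<lparr>carrier := monoid_span G S\<rparr>) \<subseteq> {\<one>}"
  proof
    fix u assume "u \<in> Units (G\<lparr>carrier := monoid_span G S\<rparr>)"
    then have u: "u \<in> monoid_span G S" and U: "u \<in> Units G"
      using c unfolding Units_def by auto
    from u show "u \<in> {\<one>}"
    proof cases
      case (mult s x)
      then have "s \<in> carrier G" "x \<in> carrier G" using S c by auto
      then have "s \<in> Units G" using U mult(1) unit_factor by blast
      then show ?thesis using mult S by auto
    qed simp
  qed
  show "{\<one>} \<subseteq> Units (G\<lparr>carrier := monoid_span G S\<rparr>)"
    unfolding Units_def by (auto intro: monoid_span.one bexI[of _ \<one>])
qed

lemma atom_monoid_span: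
  assumes S: "S \<subseteq> carrier G - Units G"
    and a: "is_atom (G\<lparr>carrier := monoid_span G S\<rparr>) a"
  shows "a \<in> S"
proof -
  note U = Units_monoid_span[OF S]
  have a': "a \<in> monoid_span G S" "a \<noteq> \<one>" using a U unfolding is_atom_def by auto
  from a'(1) show ?thesis
  proof cases
    case one
    then show ?thesis using a' by simp
  next
    case (mult s x)
    have "s \<in> monoid_span G S"
      using generator_in_monoid_span mult S by auto
    then have "s = \<one> \<or> x = \<one>"
      using a mult unfolding is_atom_def U by auto
    moreover have "s \<noteq> \<one>" using mult S by auto
    ultimately show ?thesis using mult S by auto
  qed
qed

text \<open>
  Elements of \<open>B\<close> split into two generators, which are not units, so all atoms lie in \<open>D\<close>.
  An atomic factorization of \<open>b\<close> would therefore put \<open>b\<close> into the span of \<open>D\<close>.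
\<close>

lemma not_atomic_monoid_span:
  assumes B: "B \<subseteq> carrier G - Units G" and D: "D \<subseteq> carrier G - Units G"
    and split: "\<And>b. b \<in> B \<Longrightarrow> \<exists>b'\<in>B. \<exists>d\<in>D. b = b' \<otimes> d"
    and b: "b \<in> B" "b \<notin> monoid_span G D"
  shows "\<not> atomic_monoid (G\<lparr>carrier := monoid_span G (B \<union> D)\<rparr>)"
proof
  let ?H = "G\<lparr>carrier := monoid_span G (B \<union> D)\<rparr>"
  have BD: "B \<union> D \<subseteq> carrier G - Units G" using B D by auto
  note U = Units_monoid_span[OF BD]
  have gen: "x \<in> monoid_span G (B \<union> D)" if "x \<in> B \<union> D" for x
    using generator_in_monoid_span that BD by blast
  have atom_D: "a \<in> D" if a: "is_atom ?H a" for a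
  proof (rule ccontr)
    assume "a \<notin> D"
    then have "a \<in> B" using atom_monoid_span[OF BD a] by auto
    then obtain b' d where bd: "b' \<in> B" "d \<in> D" "a = b' \<otimes> d" using split by blast
    then have "b' = \<one> \<or> d = \<one>"
      using a gen[of b'] gen[of d] unfolding is_atom_def U by auto
    then show False using bd B D by auto
  qed
  assume "atomic_monoid ?H"
  moreover have "b \<in> monoid_span G (B \<union> D)" "b \<noteq> \<one>" using gen b B by auto
  ultimately obtain as where as: "\<forall>a\<in>set as. is_atom ?H a" "b = foldr (\<otimes>) as \<one>"
    unfolding atomic_monoid_def atomic_element_def U by auto
  have "foldr (\<otimes>) as \<one> \<in> monoid_span G D"
    using as(1) by (induction as) (auto intro: monoid_span.intros atom_D)
  then show False using as b by simp
qed

end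

context comm_monoid_cancel
begin

lemma unit_if_mult_divides:
  assumes "a \<in> carrier G" "c \<in> carrier G" "a \<otimes> c divides a"
  shows "c \<in> Units G"
proof -
  obtain y where y: "y \<in> carrier G" "a = a \<otimes> c \<otimes> y" using assms(3) by (auto elim!: dividesE)
  then have "a \<otimes> \<one> = a \<otimes> (c \<otimes> y)" using assms by (simp add: m_assoc)
  then have "c \<otimes> y = \<one>" using assms y l_cancel[of a "\<one>" "c \<otimes> y"] by simp
  then have "c \<otimes> y \<in> Units G" by simp
  then show ?thesis using assms y by (intro unit_factor[of c y])
qed

section \<open>Choosing the quotients\<close>

text \<open>
  Here \<open>q i j\<close> is the quotient of the \<open>i\<close>-th by the \<open>j\<close>-th member of a strictly ascending chain of
  principal ideals. If every \<open>q N n\<close> with \<open>n > N\<close> brought \<open>b\<close> into the span, then \<open>b\<close> would have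
  infinitely many representations \<open>y k \<otimes> e k [^] m k\<close>, and Dickson's lemma would make one of
  them a proper multiple of another.
\<close>

lemma exists_avoiding_quotient:
  assumes S: "finite S" "S \<subseteq> carrier G"
    and q: "\<And>i j. i < j \<Longrightarrow> q i j \<in> carrier G - Units G"
    and q_mult: "\<And>i j k. i < j \<Longrightarrow> j < k \<Longrightarrow> q i k = q i j \<otimes> q j k"
    and b: "b \<notin> monoid_span G S"
  shows "\<exists>n>N::nat. b \<notin> monoid_span G (insert (q N n) S)"
proof (rule ccontr)
  assume neg: "\<not> ?thesis"
  define e where "e k = q N (Suc (N + k))" for k
  have e: "e k \<in> carrier G" for k unfolding e_def using q by auto
  have "\<exists>y m. y \<in> monoid_span G S \<and> b = y \<otimes> e k [^] (m::nat)" for k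
  proof -
    have "b \<in> monoid_span G (insert (e k) S)" unfolding e_def using neg by auto
    then show ?thesis using monoid_span_insert[of "e k" S b] e S by blast
  qed
  then obtain y and m :: "nat \<Rightarrow> nat"
    where y: "\<And>k. y k \<in> monoid_span G S" and b_eq: "\<And>k. b = y k \<otimes> e k [^] m k"
    by metis
  have yc: "y k \<in> carrier G" for k using y monoid_span_closed S by blast
  have m: "m k \<noteq> 0" for k
  proof
    assume "m k = 0"
    then have "b = y k" using b_eq[of k] yc by simp
    then show False using y b by simp
  qed
  obtain r :: "nat \<Rightarrow> nat" where r: "strict_mono r" "\<And>i j. i \<le> j \<Longrightarrow> y (r i) divides y (r j)"
    using monoid_span_divides_subseq[OF S, of y] y by blast
  obtain s :: "nat \<Rightarrow> nat" where s: "strict_mono s" "mono (m \<circ> r \<circ> s)"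
    using nat_seq_mono_subseq[of "m \<circ> r"] by auto
  define i j where "i = r (s 0)" and "j = r (s 1)"
  have "s 0 < s 1" using s(1) by (simp add: strict_mono_less)
  then have ij: "i < j" "y i divides y j"
    using r unfolding i_def j_def by (auto simp: strict_mono_less)
  have mij: "m i \<le> m j" using monoD[OF s(2), of 0 1] unfolding i_def j_def by simp
  \<comment> \<open>\<open>e j\<close> is a proper multiple of \<open>e i\<close>; as \<open>m j > 0\<close>, the extra factor \<open>c\<close> survives in the power.\<close>
  define c where "c = q (Suc (N + i)) (Suc (N + j))"
  have c: "c \<in> carrier G" "c \<notin> Units G" unfolding c_def using q ij by auto
  have ej: "e j = e i \<otimes> c" unfolding e_def c_def using ij by (intro q_mult) auto
  have "e i [^] m i \<otimes> c divides e i [^] m j \<otimes> c [^] m j"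
  proof (rule mult_divides_mult)
    show "e i [^] m i divides e i [^] m j" using e mij by (rule pow_divides_pow)
    show "c divides c [^] m j" using pow_divides_pow[of c 1 "m j"] c m[of j] by simp
  qed (use e c in auto)
  also have "e i [^] m j \<otimes> c [^] m j = e j [^] m j"
    using e c by (simp add: ej nat_pow_distrib)
  finally have "y i \<otimes> (e i [^] m i \<otimes> c) divides y j \<otimes> e j [^] m j"
    using ij yc e c by (intro mult_divides_mult) auto
  then have "y i \<otimes> e i [^] m i \<otimes> c divides y j \<otimes> e j [^] m j"
    using yc e c by (simp add: m_assoc)
  then have "b \<otimes> c divides b" unfolding b_eq[symmetric] .
  moreover have "b \<in> carrier G" using b_eq[of 0] yc[of 0] e[of 0] by simp
  ultimately show False using unit_if_mult_divides c by blast
qed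

section \<open>Strictly ascending chains of principal ideals\<close>

lemma l_coset_carrier_subset_iff:
  assumes "a \<in> carrier G" "b \<in> carrier G"
  shows "a <# carrier G \<subseteq> b <# carrier G \<longleftrightarrow> b divides a"
proof
  assume "a <# carrier G \<subseteq> b <# carrier G"
  moreover have "a \<in> a <# carrier G"
    using assms unfolding l_coset_def by (auto intro: bexI[of _ \<one>])
  ultimately show "b divides a" unfolding l_coset_def factor_def by auto
next
  assume "b divides a"
  then obtain c where "c \<in> carrier G" "a = b \<otimes> c" by (auto elim: dividesE)
  then show "a <# carrier G \<subseteq> b <# carrier G"
    using assms unfolding l_coset_def by (auto simp: m_assoc)
qed

text \<open>
  Passing to the infinitely many places at which the chain jumps makes every later element a
  proper divisor of every earlier one.
\<close>

lemma not_ACCP_strict_chain: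
  assumes "\<not> satisfies_ACCP G"
  shows "\<exists>B :: nat \<Rightarrow> 'a. \<exists>q. (\<forall>n. B n \<in> carrier G) \<and>
    (\<forall>i j. i < j \<longrightarrow> q i j \<in> carrier G - Units G \<and> B i = B j \<otimes> q i j)"
proof -
  obtain b where b: "\<And>n::nat. b n \<in> carrier G"
    and sub: "\<And>n. b n <# carrier G \<subseteq> b (Suc n) <# carrier G"
    and inf: "\<forall>m. \<exists>n\<ge>m. b n <# carrier G \<noteq> b (Suc n) <# carrier G"
    using assms unfolding satisfies_ACCP_def by blast
  let ?I = "{n. b n <# carrier G \<noteq> b (Suc n) <# carrier G}"
  have "infinite ?I" using inf by (auto simp: infinite_nat_iff_unbounded_le)
  then obtain e :: "nat \<Rightarrow> nat" where e: "strict_mono e" "\<And>n. e n \<in> ?I"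
    using infinite_enumerate by blast
  have mono: "b m <# carrier G \<subseteq> b n <# carrier G" if "m \<le> n" for m n
    by (rule lift_Suc_mono_le[of "\<lambda>n. b n <# carrier G"]) (use sub that in auto)
  have "\<exists>c. c \<in> carrier G - Units G \<and> b (e i) = b (e j) \<otimes> c" if "i < j" for i j
  proof -
    have "Suc (e i) \<le> e j" using e(1) that by (simp add: Suc_leI strict_mono_less)
    then have ne: "\<not> b (e j) <# carrier G \<subseteq> b (e i) <# carrier G"
      and le: "b (e i) <# carrier G \<subseteq> b (e j) <# carrier G"
      using mono[of "Suc (e i)" "e j"] sub[of "e i"] e(2)[of i] by auto
    obtain c where c: "c \<in> carrier G" "b (e i) = b (e j) \<otimes> c"
      using le b l_coset_carrier_subset_iff by (auto elim: dividesE)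
    have "c \<notin> Units G"
    proof
      assume "c \<in> Units G"
      then have "b (e j) = b (e i) \<otimes> inv c" using c b by (simp add: m_assoc)
      then show False
        using ne b l_coset_carrier_subset_iff \<open>c \<in> Units G\<close> by (auto simp: factor_def)
    qed
    then show ?thesis using c by blast
  qed
  then obtain q where "\<And>i j. i < j \<Longrightarrow> q i j \<in> carrier G - Units G \<and> b (e i) = b (e j) \<otimes> q i j"
    by metis
  then show ?thesis using b by (intro exI[of _ "\<lambda>n. b (e n)"] exI[of _ q]) auto
qed

end

section \<open>Hereditarily atomic monoids\<close>

theorem theorem4p2:
  fixes M :: "('a, 'b) monoid_scheme"
  assumes "comm_monoid_cancel M"
    and "hereditarily_atomic M"
  shows "satisfies_ACCP M"
proof (rule ccontr)
  interpret comm_monoid_cancel M by fact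
  assume "\<not> satisfies_ACCP M"
  then obtain B :: "nat \<Rightarrow> 'a" and q where B: "\<And>n. B n \<in> carrier M"
    and q: "\<And>i j. i < j \<Longrightarrow> q i j \<in> carrier M - Units M"
    and Bq: "\<And>i j. i < j \<Longrightarrow> B i = B j \<otimes>\<^bsub>M\<^esub> q i j"
    using not_ACCP_strict_chain by metis
  have q_mult: "q i k = q i j \<otimes>\<^bsub>M\<^esub> q j k" if "i < j" "j < k" for i j k
  proof -
    have c: "q i k \<in> carrier M" "q i j \<in> carrier M" "q j k \<in> carrier M"
      using q[of i k] q[of i j] q[of j k] that by auto
    have "B k \<otimes>\<^bsub>M\<^esub> q i k = B k \<otimes>\<^bsub>M\<^esub> (q i j \<otimes>\<^bsub>M\<^esub> q j k)"
      using Bq[of i k] Bq[of i j] Bq[of j k] that c B by (simp add: m_ac)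
    then show ?thesis using c B by (simp only: l_cancel m_closed)
  qed
  have B_nonunit: "B i \<in> carrier M - Units M" for i
    using Bq[of i "Suc i"] q[of i "Suc i"] B
    by (metis DiffD1 DiffD2 DiffI lessI m_comm unit_factor)
  \<comment> \<open>A state of the recursion consists of the current index \<open>n\<close> and the set \<open>S\<close> of quotients between
    consecutive indices chosen so far.\<close>
  define P where "P = (\<lambda>(k::nat) (n::nat, S).
    (k = 0 \<longrightarrow> n = 0) \<and> finite S \<and> S \<subseteq> carrier M - Units M \<and> B 0 \<notin> monoid_span M S)"
  define Q where "Q = (\<lambda>(k::nat) (n::nat, S) (n', S'). n < n' \<and> S' = insert (q n n') S)"
  have "\<exists>x. P 0 x"
    using B_nonunit[of 0] by (auto simp: P_def elim: monoid_span.cases intro!: exI[of _ "{}"])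
  moreover have "\<exists>y. P (Suc k) y \<and> Q k x y" if "P k x" for k x
  proof -
    obtain n S where x: "x = (n, S)" by (cases x)
    have S: "finite S" "S \<subseteq> carrier M - Units M" "B 0 \<notin> monoid_span M S"
      using that unfolding P_def x by auto
    obtain n' where "n' > n" "B 0 \<notin> monoid_span M (insert (q n n') S)"
      using exists_avoiding_quotient[of S q "B 0" n] S q q_mult by blast
    then have "P (Suc k) (n', insert (q n n') S) \<and> Q k x (n', insert (q n n') S)"
      using S q unfolding P_def Q_def x by auto
    then show ?thesis ..
  qed
  ultimately obtain f where f: "\<And>k. P k (f k) \<and> Q k (f k) (f (Suc k))"
    using dependent_nat_choice[of P Q] by metis
  define n S where "n k = fst (f k)" and "S k = snd (f k)" for k
  have S: "S k \<subseteq> carrier M - Units M" "B 0 \<notin> monoid_span M (S k)"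
    and n: "n k < n (Suc k)" "S (Suc k) = insert (q (n k) (n (Suc k))) (S k)" for k
    using f[of k] by (auto simp: P_def Q_def n_def S_def split: prod.splits)
  have n0: "n 0 = 0" using f[of 0] by (auto simp: P_def n_def split: prod.splits)
  let ?B = "range (\<lambda>k. B (n k))" and ?D = "\<Union>k. S k"
  have BD: "?B \<subseteq> carrier M - Units M" "?D \<subseteq> carrier M - Units M"
    using B_nonunit S(1) by blast+
  have "B 0 \<notin> monoid_span M ?D"
    using monoid_span_Union_chain[of S "B 0" M] S(2) n(2) by blast
  moreover have "B 0 \<in> ?B" using n0 by (metis rangeI)
  moreover have "\<exists>b'\<in>?B. \<exists>d\<in>?D. b = b' \<otimes>\<^bsub>M\<^esub> d" if b: "b \<in> ?B" for b
  proof -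
    obtain k where "b = B (n k)" using b by blast
    then have "b = B (n (Suc k)) \<otimes>\<^bsub>M\<^esub> q (n k) (n (Suc k))" using Bq n(1) by simp
    moreover have "q (n k) (n (Suc k)) \<in> ?D" using n(2)[of k] by blast
    ultimately show ?thesis by blast
  qed
  ultimately have "\<not> atomic_monoid (M\<lparr>carrier := monoid_span M (?B \<union> ?D)\<rparr>)"
    using not_atomic_monoid_span[OF BD] by blast
  moreover have "submonoid (monoid_span M (?B \<union> ?D)) M"
    using BD by (intro monoid_span_submonoid) blast
  ultimately show False
    using assms(2) unfolding hereditarily_atomic_def by blast
qed

end
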